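(* Let $I$ and $J$ be ideals of an $L$-algebra $X$. Then an element $y\in X$ belongs to $I\vee J$ if and only if there is an element $x\in I$ with $x\equiv y \pmod J$.
   Context: An $L$-algebra is a set $X$ with a binary operation $(x,y)\mapsto x\cdot y$ and an element $1\in X$ such that for all $x,y,z\in X$: (i) $x\cdot x=x\cdot 1=1$ and $1\cdot x=x$; (ii) $(x\cdot y)\cdot(x\cdot z)=(y\cdot x)\cdot(y\cdot z)$; (iii) $x\cdot y=y\cdot x=1$ implies $x=y$. An ideal of $X$ is a subset $I\subseteq X$ with $1\in I$ such that for all $x,y\in X$: if $x\in I$ and $x\cdot y\in I$, then $y\in I$; if $x\in I$, then $(x\cdot y)\cdot y\in I$; if $x\in I$, then $y\cdot x\in I$ and $y\cdot(x\cdot y)\in I$. The set $\mathcal{I}(X)$ of ideals, ordered by inclusion, is a complete lattice (meets are intersections); $I\vee J$ denotes the join, i.e. the smallest ideal containing $I\cup J$. For an ideal $J$, the congruence modulo $J$ is defined by $x\equiv y\pmod J:\Leftrightarrow x\cdot y\in J$ and $y\cdot x\in J$. *)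

theory Defs
  imports Main
begin

locale L_algebra =
  fixes X :: "'a set"
    and opr :: "'a \<Rightarrow> 'a \<Rightarrow> 'a" (infixr "\<cdot>" 70)
    and one :: 'a ("\<one>")
  assumes opr_closed: "\<And>x y. x \<in> X \<Longrightarrow> y \<in> X \<Longrightarrow> x \<cdot> y \<in> X"
    and one_closed: "\<one> \<in> X"
    and opr_self: "\<And>x. x \<in> X \<Longrightarrow> x \<cdot> x = \<one>"
    and opr_one: "\<And>x. x \<in> X \<Longrightarrow> x \<cdot> \<one> = \<one>"
    and one_opr: "\<And>x. x \<in> X \<Longrightarrow> \<one> \<cdot> x = x"
    and cycloid: "\<And>x y z. x \<in> X \<Longrightarrow> y \<in> X \<Longrightarrow> z \<in> X \<Longrightarrow>
      (x \<cdot> y) \<cdot> (x \<cdot> z) = (y \<cdot> x) \<cdot> (y \<cdot> z)"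
    and antisym: "\<And>x y. x \<in> X \<Longrightarrow> y \<in> X \<Longrightarrow> x \<cdot> y = \<one> \<Longrightarrow> y \<cdot> x = \<one> \<Longrightarrow> x = y"
begin

definition ideal :: "'a set \<Rightarrow> bool" where
  "ideal I \<longleftrightarrow> I \<subseteq> X \<and> \<one> \<in> I \<and>
    (\<forall>x\<in>X. \<forall>y\<in>X.
      (x \<in> I \<and> x \<cdot> y \<in> I \<longrightarrow> y \<in> I) \<and>
      (x \<in> I \<longrightarrow> (x \<cdot> y) \<cdot> y \<in> I) \<and>
      (x \<in> I \<longrightarrow> y \<cdot> x \<in> I \<and> y \<cdot> (x \<cdot> y) \<in> I))"

definition ideal_join :: "'a set \<Rightarrow> 'a set \<Rightarrow> 'a set" where
  "ideal_join I J = \<Inter>{K. ideal K \<and> I \<union> J \<subseteq> K}"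

definition cong_mod :: "'a set \<Rightarrow> 'a \<Rightarrow> 'a \<Rightarrow> bool" where
  "cong_mod J x y \<longleftrightarrow> x \<cdot> y \<in> J \<and> y \<cdot> x \<in> J"

lemma ideal_carrier: "ideal X"
  unfolding ideal_def by (simp add: opr_closed one_closed)

lemma ideal_Inter:
  assumes "\<K> \<noteq> {}" and "\<And>K. K \<in> \<K> \<Longrightarrow> ideal K"
  shows "ideal (\<Inter>\<K>)"
proof -
  obtain K where "K \<in> \<K>"
    using assms(1) by blast
  moreover have "K \<subseteq> X" if "K \<in> \<K>" for K
    using assms(2)[OF that] by (simp add: ideal_def)
  ultimately have sub: "\<Inter>\<K> \<subseteq> X"
    by blast
  have one: "\<one> \<in> \<Inter>\<K>"
    using assms(2)[unfolded ideal_def, THEN conjunct2, THEN conjunct1] by (rule InterI)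
  have closed: "(x \<in> K \<and> x \<cdot> y \<in> K \<longrightarrow> y \<in> K)
      \<and> (x \<in> K \<longrightarrow> (x \<cdot> y) \<cdot> y \<in> K)
      \<and> (x \<in> K \<longrightarrow> y \<cdot> x \<in> K \<and> y \<cdot> (x \<cdot> y) \<in> K)"
    if "K \<in> \<K>" "x \<in> X" "y \<in> X" for K x y
    using assms(2)[OF that(1), unfolded ideal_def, THEN conjunct2, THEN conjunct2,
        THEN bspec, OF that(2), THEN bspec, OF that(3)] .
  have "(x \<in> \<Inter>\<K> \<and> x \<cdot> y \<in> \<Inter>\<K> \<longrightarrow> y \<in> \<Inter>\<K>)
      \<and> (x \<in> \<Inter>\<K> \<longrightarrow> (x \<cdot> y) \<cdot> y \<in> \<Inter>\<K>)
      \<and> (x \<in> \<Inter>\<K> \<longrightarrow> y \<cdot> x \<in> \<Inter>\<K> \<and> y \<cdot> (x \<cdot> y) \<in> \<Inter>\<K>)"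
    if "x \<in> X" "y \<in> X" for x y
    using closed[OF _ that] by blast
  then show ?thesis
    unfolding ideal_def by (intro conjI[OF sub conjI[OF one]] ballI)
qed

lemma ideal_join_ideal:
  assumes "ideal I" "ideal J"
  shows "ideal (ideal_join I J)"
proof -
  have "X \<in> {K. ideal K \<and> I \<union> J \<subseteq> K}"
    using assms ideal_carrier by (simp add: ideal_def)
  then have "{K. ideal K \<and> I \<union> J \<subseteq> K} \<noteq> {}"
    by blast
  then show ?thesis
    unfolding ideal_join_def by (rule ideal_Inter) simp
qed

lemma ideal_join_upper: "I \<union> J \<subseteq> ideal_join I J"
  unfolding ideal_join_def by blast

lemma ideal_join_least: "ideal K \<Longrightarrow> I \<union> J \<subseteq> K \<Longrightarrow> ideal_join I J \<subseteq> K"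
  unfolding ideal_join_def by blast

end

end

(* The union of the J-classes meeting I is an ideal. The only closure property that does not
   follow at once from compatibility of congruences is detachment: if x, x' \<in> I and
   x' \<equiv> x \<cdot> b (mod J), put k = x' \<cdot> (x \<cdot> b) \<in> J. Then k \<cdot> (x \<cdot> b) \<in> I because x' \<in> I, and it is
   congruent mod I to k \<cdot> b because x \<equiv> 1 (mod I); so k \<cdot> b is an element of I, and it is
   congruent to b mod J because k \<in> J. *)
theory Submission
  imports Defs
begin

context L_algebra
begin

lemma ideal_subset: "ideal J \<Longrightarrow> x \<in> J \<Longrightarrow> x \<in> X"
  unfolding ideal_def by blast

lemma ideal_one: "ideal J \<Longrightarrow> \<one> \<in> J"
  unfolding ideal_def by blast

lemma ideal_detach: "ideal J \<Longrightarrow> x \<in> J \<Longrightarrow> x \<cdot> y \<in> J \<Longrightarrow> y \<in> X \<Longrightarrow> y \<in> J"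
  unfolding ideal_def by blast

lemma ideal_opr_opr: "ideal J \<Longrightarrow> x \<in> J \<Longrightarrow> y \<in> X \<Longrightarrow> (x \<cdot> y) \<cdot> y \<in> J"
  unfolding ideal_def by blast

lemma ideal_opr: "ideal J \<Longrightarrow> x \<in> J \<Longrightarrow> y \<in> X \<Longrightarrow> y \<cdot> x \<in> J"
  unfolding ideal_def by blast

lemma ideal_opr_swap: "ideal J \<Longrightarrow> x \<in> J \<Longrightarrow> y \<in> X \<Longrightarrow> y \<cdot> (x \<cdot> y) \<in> J"
  unfolding ideal_def by blast

lemma cong_mod_refl: "ideal J \<Longrightarrow> x \<in> X \<Longrightarrow> cong_mod J x x"
  by (simp add: cong_mod_def opr_self ideal_one)

lemma cong_mod_sym: "cong_mod J x y \<Longrightarrow> cong_mod J y x"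
  by (simp add: cong_mod_def)

lemma cong_mod_trans:
  assumes J: "ideal J" and X: "x \<in> X" "y \<in> X" "z \<in> X"
    and xy: "cong_mod J x y" and yz: "cong_mod J y z"
  shows "cong_mod J x z"
proof -
  \<comment> \<open>Already the one-sided relation u \<cdot> v \<in> J is transitive:
    \<open>cycloid\<close> rewrites (u \<cdot> v) \<cdot> (u \<cdot> w) as (v \<cdot> u) \<cdot> (v
    \<cdot> w), a left multiple of v \<cdot> w \<in> J, and detaching u \<cdot> v leaves u \<cdot>
    w. Both directions of the congruence are instances.\<close>
  have *: "u \<cdot> w \<in> J" if "u \<in> X" "v \<in> X" "w \<in> X" "u \<cdot> v \<in> J" "v \<cdot> w \<in> J" for u v w
  proof -
    have "(u \<cdot> v) \<cdot> (u \<cdot> w) \<in> J"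
      using cycloid[of u v w] ideal_opr[OF J, of "v \<cdot> w" "v \<cdot> u"] that by (simp add: opr_closed)
    then show ?thesis
      using ideal_detach[OF J] that opr_closed by blast
  qed
  show ?thesis
    using *[of x y z] *[of z y x] X xy yz by (simp add: cong_mod_def)
qed

text \<open>By \<open>cycloid\<close>, (z \<cdot> x) \<cdot> (z \<cdot> y) = (x \<cdot> z) \<cdot>
  (x \<cdot> y), a left multiple of x \<cdot> y \<in> J; the other direction is symmetric.\<close>

lemma cong_mod_opr_right:
  assumes "ideal J" "x \<in> X" "y \<in> X" "z \<in> X" "cong_mod J x y"
  shows "cong_mod J (z \<cdot> x) (z \<cdot> y)"
  using assms ideal_opr[of J "x \<cdot> y" "x \<cdot> z"] ideal_opr[of J "y \<cdot> x" "y \<cdot> z"]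
    cycloid[of z x y] cycloid[of z y x]
  by (simp add: cong_mod_def opr_closed)

text \<open>Modulo J, an element of J acts from the left as \<one> does. The closure of J under (x
  \<cdot> y) \<cdot> y and under y \<cdot> (x \<cdot> y) supplies the two halves.\<close>

lemma cong_mod_ideal_opr: "ideal J \<Longrightarrow> j \<in> J \<Longrightarrow> w \<in> X \<Longrightarrow> cong_mod J (j \<cdot> w) w"
  by (simp add: cong_mod_def ideal_opr_opr ideal_opr_swap)

text \<open>The common value (x \<cdot> y) \<cdot> (x \<cdot> z) = (y \<cdot> x) \<cdot> (y \<cdot>
  z) links the two sides: since x \<cdot> y and y \<cdot> x lie in J, it is congruent both to x
  \<cdot> z and to y \<cdot> z.\<close>

lemma cong_mod_opr_left:
  assumes J: "ideal J" and X: "x \<in> X" "y \<in> X" "z \<in> X" and xy: "cong_mod J x y"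
  shows "cong_mod J (x \<cdot> z) (y \<cdot> z)"
proof -
  have "cong_mod J ((x \<cdot> y) \<cdot> (x \<cdot> z)) (x \<cdot> z)" "cong_mod J ((x \<cdot> y) \<cdot> (x \<cdot> z)) (y \<cdot> z)"
    using cong_mod_ideal_opr[OF J, of "x \<cdot> y" "x \<cdot> z"] cong_mod_ideal_opr[OF J, of "y \<cdot> x" "y \<cdot> z"]
      xy X cycloid[of x y z] by (simp_all add: cong_mod_def opr_closed)
  then show ?thesis
    using cong_mod_trans[OF J, of "x \<cdot> z" "(x \<cdot> y) \<cdot> (x \<cdot> z)" "y \<cdot> z"] X
    by (simp add: opr_closed cong_mod_sym[of J "(x \<cdot> y) \<cdot> (x \<cdot> z)" "x \<cdot> z"])
qed

lemma cong_mod_ideal: "ideal J \<Longrightarrow> x \<in> J \<Longrightarrow> y \<in> X \<Longrightarrow> cong_mod J x y \<Longrightarrow> y \<in> J"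
  unfolding cong_mod_def using ideal_detach by blast

lemma cong_mod_one: "ideal J \<Longrightarrow> x \<in> J \<Longrightarrow> cong_mod J \<one> x"
  by (simp add: cong_mod_def one_opr opr_one ideal_one ideal_subset)

lemma ideal_saturation:
  assumes I: "ideal I" and J: "ideal J"
  shows "ideal {y \<in> X. \<exists>x\<in>I. cong_mod J x y}" (is "ideal ?K")
proof -
  note [simp] = opr_closed one_closed ideal_subset[OF I] ideal_subset[OF J]
  have detach: "b \<in> ?K" if "a \<in> ?K" "a \<cdot> b \<in> ?K" and [simp]: "b \<in> X" for a b
  proof -
    obtain x where x [simp]: "x \<in> I" "a \<in> X" "cong_mod J x a"
      using \<open>a \<in> ?K\<close> by blast
    obtain x' where x' [simp]: "x' \<in> I" "cong_mod J x' (a \<cdot> b)"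
      using \<open>a \<cdot> b \<in> ?K\<close> by blast
    define k where "k = x' \<cdot> (x \<cdot> b)"
    \<comment> \<open>Replacing \<open>a\<close> by its representative \<open>x\<close> in I moves
      the problem to x' \<equiv> x \<cdot> b (mod J), where both \<open>x\<close> and
      \<open>x'\<close> are in I.\<close>
    have "cong_mod J (a \<cdot> b) (x \<cdot> b)"
      by (rule cong_mod_opr_left[OF J]) (simp_all add: cong_mod_sym[OF x(3)])
    then have "cong_mod J x' (x \<cdot> b)"
      using cong_mod_trans[OF J, of x' "a \<cdot> b" "x \<cdot> b"] by simp
    then have k [simp]: "k \<in> J"
      by (simp add: k_def cong_mod_def)
    have kI: "k \<cdot> (x \<cdot> b) \<in> I"
      unfolding k_def by (rule ideal_opr_opr[OF I]) simp_all
    have "cong_mod I (k \<cdot> (x \<cdot> b)) (k \<cdot> b)"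
      by (rule cong_mod_opr_right[OF I]) (simp_all add: cong_mod_ideal_opr[OF I])
    then have "k \<cdot> b \<in> I"
      by (rule cong_mod_ideal[OF I kI, rotated]) simp
    moreover have "cong_mod J (k \<cdot> b) b"
      by (simp add: cong_mod_ideal_opr[OF J])
    ultimately show ?thesis
      by auto
  qed
  \<comment> \<open>Each witness is the same term with \<open>a\<close> replaced by its
    representative \<open>x\<close>; it lies in I because I is an ideal.\<close>
  have closed: "(a \<cdot> b) \<cdot> b \<in> ?K" "b \<cdot> a \<in> ?K" "b \<cdot> (a \<cdot> b) \<in> ?K"
    if "a \<in> ?K" and [simp]: "b \<in> X" for a b
  proof -
    obtain x where x [simp]: "x \<in> I" "a \<in> X" "cong_mod J x a"
      using \<open>a \<in> ?K\<close> by blast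
    have xb [simp]: "cong_mod J (x \<cdot> b) (a \<cdot> b)"
      by (rule cong_mod_opr_left[OF J]) simp_all
    have "cong_mod J ((x \<cdot> b) \<cdot> b) ((a \<cdot> b) \<cdot> b)"
      by (rule cong_mod_opr_left[OF J]) simp_all
    moreover have "cong_mod J (b \<cdot> x) (b \<cdot> a)" "cong_mod J (b \<cdot> (x \<cdot> b)) (b \<cdot> (a \<cdot> b))"
      by (rule cong_mod_opr_right[OF J]; simp)+
    moreover have "(x \<cdot> b) \<cdot> b \<in> I" "b \<cdot> x \<in> I" "b \<cdot> (x \<cdot> b) \<in> I"
      by (simp_all add: ideal_opr_opr[OF I] ideal_opr[OF I] ideal_opr_swap[OF I])
    ultimately show "(a \<cdot> b) \<cdot> b \<in> ?K" "b \<cdot> a \<in> ?K" "b \<cdot> (a \<cdot> b) \<in> ?K"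
      by auto
  qed
  have one: "\<one> \<in> ?K"
    using ideal_one[OF I] cong_mod_refl[OF J one_closed] one_closed by blast
  show ?thesis
    unfolding ideal_def
    by (intro conjI ballI impI one) (blast, erule conjE, (rule detach closed; assumption)+)
qed

lemma ideal_join_eq_saturation:
  assumes I: "ideal I" and J: "ideal J"
  shows "ideal_join I J = {y \<in> X. \<exists>x\<in>I. cong_mod J x y}" (is "_ = ?K")
proof
  \<comment> \<open>An element of I is its own witness; for an element of J the witness is
    \<one>.\<close>
  have "I \<subseteq> ?K"
    using cong_mod_refl[OF J] ideal_subset[OF I] by blast
  moreover have "J \<subseteq> ?K"
    using cong_mod_one[OF J] ideal_one[OF I] ideal_subset[OF J] by blast
  ultimately show "ideal_join I J \<subseteq> ?K"
    by (intro ideal_join_least ideal_saturation I J Un_least)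
next
  \<comment> \<open>The join contains x \<in> I and x \<cdot> y \<in> J, so detachment puts
    \<open>y\<close> into it.\<close>
  show "?K \<subseteq> ideal_join I J"
  proof
    fix y assume "y \<in> ?K"
    then obtain x where "y \<in> X" "x \<in> I" "x \<cdot> y \<in> J"
      unfolding cong_mod_def by blast
    then show "y \<in> ideal_join I J"
      using ideal_detach[OF ideal_join_ideal[OF I J], of x y] ideal_join_upper[of I J] by blast
  qed
qed

end

theorem proposition2:
  fixes X I J :: "'a set"
    and opr :: "'a \<Rightarrow> 'a \<Rightarrow> 'a"
    and one :: 'a
  assumes "L_algebra X opr one"
    and "L_algebra.ideal X opr one I"
    and "L_algebra.ideal X opr one J"
    and "y \<in> X"
  shows "y \<in> L_algebra.ideal_join X opr one I J \<longleftrightarrow>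
    (\<exists>x\<in>I. L_algebra.cong_mod opr J x y)"
  using L_algebra.ideal_join_eq_saturation[OF assms(1-3)] assms(4) by simp

end
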